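(* Let $G=\{g\in SO(8):\ \forall q,q'\in\mathbb{O},\ B(q,q')=0\Longleftrightarrow B(gq,gq')=0\}$. Then $G$ is the largest subgroup of $GL(8,\mathbb{R})$ which stabilizes $V$. Let $G^0$ be the identity component of $G$. There exists a surjective group morphism $\theta\colon G\to O(3)\subset O(4)$, where $O(3)$ is identified with the group of linear isometries of $\mathbb{H}$ fixing $1$, such that $\theta^{-1}(SO(3))=G^0$ and $\theta^{-1}(O^-(3))=L_{E^\downarrow}G^0$, hence $$G=G^0\sqcup L_{E^\downarrow}G^0,$$ and such that every $g\in G^0$ can be written $g=\begin{pmatrix}R_a\theta(g)&0\\0&R_b\theta(g)\end{pmatrix}$ (with some $a,b\in S^3$). More precisely, $$G^0=\left\{\begin{pmatrix}R_aL_c&0\\0&R_bL_c\end{pmatrix}:\ a,b,c\in S^3\right\}.$$ Moreover, for every $g\in G$ and all $q,q'\in\mathbb{O}$, $B(gq,gq')=\theta(g)(B(q,q'))$. Furthermore, for every $g\in G^0$, $\theta(L_{E^\downarrow}g)=\theta(g)\circ *=*\circ\theta(g)$, where $*$ is the conjugation of $\mathbb{H}$ (which is the element $-I_3$ of $O(\operatorname{Im}\mathbb{H})=O(3)$). Finally, on $G^0$, $\theta(\mathrm{Diag}(R_aL_c,R_bL_c))=\mathrm{Int}_c=(x\in\operatorname{Im}\mathbb{H}\mapsto cxc^{-1})$ for $a,b,c\in S^3$.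
   Context: $\mathbb{H}$ denotes the quaternions with conjugation $x\mapsto\bar x$, $S^3$ the unit quaternions, $\operatorname{Im}\mathbb{H}$ the purely imaginary quaternions; $L_c(x)=cx$, $R_a(x)=xa$ on $\mathbb{H}$. $\mathbb{O}=\mathbb{H}^2=\mathbb{R}^8$ are the octonions, with product $(x,y)\cdot(x',y')=(xx'-y'\bar y,\ x'y+\bar x y')$ and the standard Euclidean norm; $S^7$ is its unit sphere. For endomorphisms $A,D$ of $\mathbb{H}$, $\mathrm{Diag}(A,D)=\begin{pmatrix}A&0\\0&D\end{pmatrix}$ maps $(x,y)$ to $(Ax,Dy)$. $E^\downarrow=(0,1)\in\mathbb{O}$ and $L_{E^\downarrow}$ is left octonion multiplication by $E^\downarrow$, i.e. $L_{E^\downarrow}(x,y)=(-y,x)$. For $q=(x,y)$, $q'=(x',y')$, $B(q,q')=x\overline{x'}+y'\overline{y}\in\mathbb{H}$, and $V=\{(q,q')\in S^7\times S^7:\ B(q,q')=0\}$; $GL(8,\mathbb{R})$ acts on pairs by $g\cdot(q,q')=(gq,gq')$. $O^-(3)$ is the set of elements of $O(3)$ with determinant $-1$. *)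

theory Defs
  imports "HOL-Analysis.Analysis" "HOL-Algebra.Coset"
begin

section \<open>Quaternions\<close>

codatatype quat = Quat (qRe: real) (qI: real) (qJ: real) (qK: real)

lemma quat_eqI [intro?]:
  "qRe x = qRe y \<Longrightarrow> qI x = qI y \<Longrightarrow> qJ x = qJ y \<Longrightarrow> qK x = qK y \<Longrightarrow> x = y"
  by (rule quat.expand) simp

lemma quat_eq_iff:
  "x = y \<longleftrightarrow> qRe x = qRe y \<and> qI x = qI y \<and> qJ x = qJ y \<and> qK x = qK y"
  by (auto intro: quat.expand)

instantiation quat :: ab_group_add
begin

primcorec zero_quat where
  "qRe 0 = 0" | "qI 0 = 0" | "qJ 0 = 0" | "qK 0 = 0"

primcorec plus_quat where
    "qRe (x + y) = qRe x + qRe y"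
  | "qI (x + y) = qI x + qI y"
  | "qJ (x + y) = qJ x + qJ y"
  | "qK (x + y) = qK x + qK y"

primcorec uminus_quat where
    "qRe (- x) = - qRe x"
  | "qI (- x) = - qI x"
  | "qJ (- x) = - qJ x"
  | "qK (- x) = - qK x"

primcorec minus_quat where
    "qRe (x - y) = qRe x - qRe y"
  | "qI (x - y) = qI x - qI y"
  | "qJ (x - y) = qJ x - qJ y"
  | "qK (x - y) = qK x - qK y"

instance
  by standard (simp_all add: quat_eq_iff)

end

lemma quat_sum_squares_eq_0_iff:
  "(qRe x)\<^sup>2 + (qI x)\<^sup>2 + (qJ x)\<^sup>2 + (qK x)\<^sup>2 = 0 \<longleftrightarrow> x = 0"
  by (simp add: quat_eq_iff add_nonneg_eq_0_iff)

instantiation quat :: division_ring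
begin

primcorec one_quat where
  "qRe 1 = 1" | "qI 1 = 0" | "qJ 1 = 0" | "qK 1 = 0"

primcorec times_quat where
    "qRe (x * y) = qRe x * qRe y - qI x * qI y - qJ x * qJ y - qK x * qK y"
  | "qI (x * y) = qRe x * qI y + qI x * qRe y + qJ x * qK y - qK x * qJ y"
  | "qJ (x * y) = qRe x * qJ y - qI x * qK y + qJ x * qRe y + qK x * qI y"
  | "qK (x * y) = qRe x * qK y + qI x * qJ y - qJ x * qI y + qK x * qRe y"

primcorec inverse_quat where
    "qRe (inverse x) = qRe x / ((qRe x)\<^sup>2 + (qI x)\<^sup>2 + (qJ x)\<^sup>2 + (qK x)\<^sup>2)"
  | "qI (inverse x) = - qI x / ((qRe x)\<^sup>2 + (qI x)\<^sup>2 + (qJ x)\<^sup>2 + (qK x)\<^sup>2)"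
  | "qJ (inverse x) = - qJ x / ((qRe x)\<^sup>2 + (qI x)\<^sup>2 + (qJ x)\<^sup>2 + (qK x)\<^sup>2)"
  | "qK (inverse x) = - qK x / ((qRe x)\<^sup>2 + (qI x)\<^sup>2 + (qJ x)\<^sup>2 + (qK x)\<^sup>2)"

definition "x div y = x * inverse y" for x y :: quat

instance
proof
  fix x y z :: quat
  show "x * y * z = x * (y * z)" by (simp add: quat_eq_iff algebra_simps)
  show "1 * x = x" by (simp add: quat_eq_iff)
  show "x * 1 = x" by (simp add: quat_eq_iff)
  show "(x + y) * z = x * z + y * z" by (simp add: quat_eq_iff algebra_simps)
  show "x * (y + z) = x * y + x * z" by (simp add: quat_eq_iff algebra_simps)
  show "(0::quat) \<noteq> 1" by (simp add: quat_eq_iff)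
  show "inverse (0::quat) = 0" by (simp add: quat_eq_iff)
  show "x div y = x * inverse y" by (rule divide_quat_def)
next
  fix x :: quat
  assume "x \<noteq> 0"
  then have nz: "(qRe x)\<^sup>2 + (qI x)\<^sup>2 + (qJ x)\<^sup>2 + (qK x)\<^sup>2 \<noteq> 0"
    by (simp only: quat_sum_squares_eq_0_iff not_False_eq_True)
  define n where "n = (qRe x)\<^sup>2 + (qI x)\<^sup>2 + (qJ x)\<^sup>2 + (qK x)\<^sup>2"
  have n: "n \<noteq> 0" "n = qRe x * qRe x + qI x * qI x + qJ x * qJ x + qK x * qK x"
    using nz by (simp_all add: n_def power2_eq_square)
  have 1: "qRe x * qRe x / n + qI x * qI x / n + qJ x * qJ x / n + qK x * qK x / n = 1"
    using n(1) by (simp flip: add_divide_distrib n(2))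
  show "inverse x * x = 1" "x * inverse x = 1"
    using 1 by (simp_all add: quat_eq_iff mult.commute flip: n_def)
qed

end

instantiation quat :: real_algebra_1
begin

primcorec scaleR_quat where
    "qRe (scaleR r x) = r * qRe x"
  | "qI (scaleR r x) = r * qI x"
  | "qJ (scaleR r x) = r * qJ x"
  | "qK (scaleR r x) = r * qK x"

instance
  by standard (simp_all add: quat_eq_iff algebra_simps)

end

instance quat :: real_div_algebra ..

instantiation quat :: real_inner
begin

definition inner_quat_def:
  "inner x y = qRe x * qRe y + qI x * qI y + qJ x * qJ y + qK x * qK y"

definition norm_quat_def: "norm (x::quat) = sqrt (inner x x)"

definition sgn_quat_def: "sgn (x::quat) = x /\<^sub>R norm x"

definition dist_quat_def: "dist (x::quat) y = norm (x - y)"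

definition uniformity_quat_def [code del]:
  "(uniformity :: (quat \<times> quat) filter) = (INF e\<in>{0 <..}. principal {(x, y). dist x y < e})"

definition open_quat_def [code del]:
  "open (U :: quat set) \<longleftrightarrow> (\<forall>x\<in>U. eventually (\<lambda>(x', y). x' = x \<longrightarrow> y \<in> U) uniformity)"

instance
proof
  fix x y z :: quat and r :: real
  show "inner x y = inner y x"
    by (simp add: inner_quat_def mult.commute)
  show "inner (x + y) z = inner x z + inner y z"
    by (simp add: inner_quat_def distrib_right)
  show "inner (scaleR r x) y = r * inner x y"
    by (simp add: inner_quat_def distrib_left)
  show "0 \<le> inner x x"
    by (simp add: inner_quat_def)
  show "inner x x = 0 \<longleftrightarrow> x = 0"
    using quat_sum_squares_eq_0_iff[of x] by (simp add: inner_quat_def power2_eq_square)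
qed (rule norm_quat_def sgn_quat_def dist_quat_def uniformity_quat_def open_quat_def)+

end

instance quat :: real_normed_div_algebra
proof
  fix x y :: quat
  have "inner (x * y) (x * y) = inner x x * inner y y"
    by (simp add: inner_quat_def algebra_simps)
  then show "norm (x * y) = norm x * norm y"
    by (simp add: norm_quat_def real_sqrt_mult)
qed

instantiation quat :: euclidean_space
begin

definition Basis_quat_def:
  "Basis = {1, Quat 0 1 0 0, Quat 0 0 1 0, Quat 0 0 0 1}"

instance
proof
  show "Basis \<noteq> ({} :: quat set)" "finite (Basis :: quat set)"
    by (simp_all add: Basis_quat_def)
  show "inner u v = (if u = v then 1 else 0)" if "u \<in> Basis" "v \<in> Basis" for u v :: quat
    using that unfolding Basis_quat_def insert_iff empty_iff
    by (elim disjE FalseE) (simp_all add: inner_quat_def quat_eq_iff)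
  show "(\<forall>u\<in>Basis. inner x u = 0) \<longleftrightarrow> x = 0" for x :: quat
    unfolding quat_eq_iff[of x] by (simp add: Basis_quat_def inner_quat_def)
qed

end

lift_definition qcnj :: "quat \<Rightarrow>\<^sub>L quat" is "\<lambda>x. Quat (qRe x) (- qI x) (- qJ x) (- qK x)"
proof (rule bounded_linear_intro[where K = 1])
qed (simp_all add: quat_eq_iff norm_quat_def inner_quat_def)

definition ImH :: "quat set" where "ImH = {x. qRe x = 0}"

definition S3 :: "quat set" where "S3 = sphere 0 1"

abbreviation Lmul :: "quat \<Rightarrow> quat \<Rightarrow>\<^sub>L quat" where "Lmul c \<equiv> blinfun_mult_right c"
abbreviation Rmul :: "quat \<Rightarrow> quat \<Rightarrow>\<^sub>L quat" where "Rmul a \<equiv> blinfun_mult_left a"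

lemma "Lmul c x = c * x" "Rmul a x = x * a"
  by simp_all


section \<open>Linear groups\<close>

text \<open>
  The topology on linear groups is the one induced by the operator norm on \<^typ>\<open>'a \<Rightarrow>\<^sub>L 'a\<close>;
  since the space is finite-dimensional, this is the usual one.
\<close>

definition GL :: "('a::euclidean_space \<Rightarrow>\<^sub>L 'a) monoid" where
  "GL = \<lparr>carrier = {g. bij (blinfun_apply g)}, mult = (o\<^sub>L), one = id_blinfun\<rparr>"

lemma group_GL: "group (GL :: ('a::euclidean_space \<Rightarrow>\<^sub>L 'a) monoid)"
proof (rule groupI)
  fix f g h :: "'a \<Rightarrow>\<^sub>L 'a"
  show "f \<otimes>\<^bsub>GL\<^esub> g \<otimes>\<^bsub>GL\<^esub> h = f \<otimes>\<^bsub>GL\<^esub> (g \<otimes>\<^bsub>GL\<^esub> h)"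
    by (auto simp: GL_def intro!: blinfun_eqI)
  show "\<one>\<^bsub>GL\<^esub> \<otimes>\<^bsub>GL\<^esub> f = f"
    by (auto simp: GL_def intro!: blinfun_eqI)
  assume f: "f \<in> carrier GL"
  show "f \<otimes>\<^bsub>GL\<^esub> g \<in> carrier GL" if "g \<in> carrier GL"
    using f that by (auto simp: GL_def blinfun_apply_blinfun_compose[abs_def]
        intro: bij_comp[unfolded comp_def])
  define k where "k = Blinfun (inv_into UNIV (blinfun_apply f))"
  have lin: "linear (blinfun_apply f)"
    by (simp add: blinfun.bounded_linear_right bounded_linear.linear)
  have b: "bij (blinfun_apply f)"
    using f by (simp add: GL_def)
  have "linear (inv_into UNIV (blinfun_apply f))"
    using lin b by (simp add: bij_is_inj bij_is_surj linear_injective_imp_surjective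
        inj_linear_imp_inv_linear)
  then have k: "blinfun_apply k = inv_into UNIV (blinfun_apply f)"
    by (simp add: k_def bounded_linear_Blinfun_apply linear_conv_bounded_linear)
  have "k \<in> carrier GL"
    using b by (simp add: GL_def k bij_imp_bij_inv)
  moreover have "k \<otimes>\<^bsub>GL\<^esub> f = \<one>\<^bsub>GL\<^esub>"
    using b by (auto simp: GL_def k bij_is_inj intro!: blinfun_eqI)
  ultimately show "\<exists>k\<in>carrier GL. k \<otimes>\<^bsub>GL\<^esub> f = \<one>\<^bsub>GL\<^esub>"
    by blast
qed (simp add: GL_def flip: id_def)

text \<open>
  \<open>O3\<close> is the group of linear isometries of the quaternions fixing 1, a subgroup of
  \<open>O4\<close>.  Such an isometry preserves \<^const>\<open>ImH\<close>, and \<open>Im_matrix\<close> is the matrix of its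
  restriction to \<^const>\<open>ImH\<close> in the basis i, j, k; the determinant distinguishing \<open>SO3\<close> from
  its complement is that of this 3-by-3 matrix.
\<close>

definition O4 :: "(quat \<Rightarrow>\<^sub>L quat) set" where
  "O4 = {f. orthogonal_transformation (blinfun_apply f)}"

definition O3 :: "(quat \<Rightarrow>\<^sub>L quat) set" where
  "O3 = {f \<in> O4. f 1 = 1}"

lemma O3_subset_O4: "O3 \<subseteq> O4"
  by (auto simp: O3_def)

lemma O3_ImH: "f x \<in> ImH" if "f \<in> O3" "x \<in> ImH"
proof -
  have "inner (f x) (f 1) = inner x 1"
    using that(1) unfolding O3_def O4_def orthogonal_transformation_def by blast
  with that show ?thesis
    by (simp add: O3_def ImH_def inner_quat_def)
qed

lemma subgroup_O4: "subgroup O4 GL"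
proof (rule group.subgroupI[OF group_GL])
  show sub: "O4 \<subseteq> carrier GL"
    by (auto simp: O4_def GL_def orthogonal_transformation_bij)
  show "O4 \<noteq> {}"
    by (auto simp: O4_def orthogonal_transformation_def blinfun.bounded_linear_right
        bounded_linear.linear intro!: exI[of _ id_blinfun])
  fix f g assume f: "f \<in> O4"
  show "f \<otimes>\<^bsub>GL\<^esub> g \<in> O4" if "g \<in> O4"
    using f that by (auto simp: O4_def GL_def orthogonal_transformation_def
        blinfun.bounded_linear_right bounded_linear.linear)
  define h where "h = inv\<^bsub>GL\<^esub> f"
  have "f \<otimes>\<^bsub>GL\<^esub> h = \<one>\<^bsub>GL\<^esub>"
    using f sub by (auto simp: h_def group.r_inv[OF group_GL])
  then have r: "f (h x) = x" for x
    by (metis GL_def blinfun_apply_blinfun_compose blinfun_apply_id_blinfun id_apply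
        monoid.select_convs(1,2))
  have "inner (h v) (h w) = inner v w" for v w
    using f r[of v] r[of w] by (metis (mono_tags) O4_def mem_Collect_eq orthogonal_transformation_def)
  then show "inv\<^bsub>GL\<^esub> f \<in> O4"
    by (simp add: O4_def orthogonal_transformation_def blinfun.bounded_linear_right
        bounded_linear.linear flip: h_def)
qed

lemma subgroup_O3: "subgroup O3 GL"
proof (rule group.subgroupI[OF group_GL])
  show "O3 \<subseteq> carrier GL"
    using O3_subset_O4 subgroup.subset[OF subgroup_O4] by blast
  show "O3 \<noteq> {}"
    using subgroup.one_closed[OF subgroup_O4] by (auto simp: O3_def GL_def)
  fix f g assume f: "f \<in> O3"
  show "f \<otimes>\<^bsub>GL\<^esub> g \<in> O3" if "g \<in> O3"
    using f that subgroup.m_closed[OF subgroup_O4, of f g] by (simp add: O3_def GL_def)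
  have "f \<in> carrier GL"
    using f O3_subset_O4 subgroup.subset[OF subgroup_O4] by blast
  then have "inv\<^bsub>GL\<^esub> f \<otimes>\<^bsub>GL\<^esub> f = \<one>\<^bsub>GL\<^esub>"
    by (rule group.l_inv[OF group_GL])
  then have "(inv\<^bsub>GL\<^esub> f) (f x) = x" for x
    by (metis GL_def blinfun_apply_blinfun_compose blinfun_apply_id_blinfun id_apply
        monoid.select_convs(1,2))
  from this[of 1] have "(inv\<^bsub>GL\<^esub> f) 1 = 1"
    using f by (simp add: O3_def)
  then show "inv\<^bsub>GL\<^esub> f \<in> O3"
    using f subgroup.m_inv_closed[OF subgroup_O4, of f] by (simp add: O3_def)
qed

definition O3_group :: "(quat \<Rightarrow>\<^sub>L quat) monoid" where
  "O3_group = GL\<lparr>carrier := O3\<rparr>"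

definition Im_matrix :: "(quat \<Rightarrow>\<^sub>L quat) \<Rightarrow> real^3^3" where
  "Im_matrix f = matrix (\<lambda>v. let x = f (Quat 0 (v$1) (v$2) (v$3)) in vector [qI x, qJ x, qK x])"

definition SO3 :: "(quat \<Rightarrow>\<^sub>L quat) set" where
  "SO3 = {f \<in> O3. det (Im_matrix f) = 1}"

definition O3_minus :: "(quat \<Rightarrow>\<^sub>L quat) set" where
  "O3_minus = {f \<in> O3. det (Im_matrix f) = -1}"

definition Int_quat :: "quat \<Rightarrow> quat \<Rightarrow>\<^sub>L quat" where
  "Int_quat c = Lmul c o\<^sub>L Rmul (inverse c)"

lemma Int_quat_apply: "Int_quat c x = c * x * inverse c"
  by (simp add: Int_quat_def mult.assoc)


section \<open>Octonions\<close>

type_synonym oct = "quat \<times> quat"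

fun oct_mult :: "oct \<Rightarrow> oct \<Rightarrow> oct" where
  "oct_mult (x, y) (x', y') = (x * x' - y' * qcnj y, x' * y + qcnj x * y')"

lemma bounded_linear_oct_mult: "bounded_linear (oct_mult q)"
proof -
  obtain x y where q: "q = (x, y)" by (cases q)
  have "oct_mult q = (\<lambda>p. (x * fst p - snd p * qcnj y, fst p * y + qcnj x * snd p))"
    by (auto simp: fun_eq_iff q)
  moreover have "bounded_linear \<dots>"
    by (intro bounded_linear_Pair bounded_linear_sub bounded_linear_add bounded_linear_const_mult
        bounded_linear_mult_const bounded_linear_fst bounded_linear_snd)
  ultimately show ?thesis by simp
qed

lift_definition oct_Lmul :: "oct \<Rightarrow> oct \<Rightarrow>\<^sub>L oct" is oct_mult
  by (rule bounded_linear_oct_mult)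

definition E_down :: oct where "E_down = (0, 1)"

lemma oct_Lmul_E_down: "oct_Lmul E_down (x, y) = (- y, x)"
  by (simp add: oct_Lmul.rep_eq E_down_def qcnj.rep_eq quat_eq_iff)

lift_definition Diag :: "(quat \<Rightarrow>\<^sub>L quat) \<Rightarrow> (quat \<Rightarrow>\<^sub>L quat) \<Rightarrow> (oct \<Rightarrow>\<^sub>L oct)" is
  "\<lambda>A D (x, y). (A x, D y)"
  unfolding case_prod_beta
  by (intro bounded_linear_Pair bounded_linear_compose[OF _ bounded_linear_fst]
      bounded_linear_compose[OF _ bounded_linear_snd])

fun oct_to_vec :: "oct \<Rightarrow> real^8" where
  "oct_to_vec (x, y) = vector [qRe x, qI x, qJ x, qK x, qRe y, qI y, qJ y, qK y]"

definition vec_to_oct :: "real^8 \<Rightarrow> oct" where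
  "vec_to_oct v = (Quat (v$1) (v$2) (v$3) (v$4), Quat (v$5) (v$6) (v$7) (v$8))"

lemma exhaust_8:
  fixes x :: 8
  shows "x = 1 \<or> x = 2 \<or> x = 3 \<or> x = 4 \<or> x = 5 \<or> x = 6 \<or> x = 7 \<or> x = 8"
proof (induct x)
  case (of_int z)
  then have "0 \<le> z" and "z < 8" by simp_all
  then have "z = 0 \<or> z = 1 \<or> z = 2 \<or> z = 3 \<or> z = 4 \<or> z = 5 \<or> z = 6 \<or> z = 7" by arith
  then show ?case by auto
qed

lemma vec_to_oct_oct_to_vec: "vec_to_oct (oct_to_vec q) = q"
  by (cases q) (simp add: vec_to_oct_def vector_def)

lemma oct_to_vec_vec_to_oct: "oct_to_vec (vec_to_oct v) = v"
proof -
  have "oct_to_vec (vec_to_oct v) $ i = v $ i" for i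
    using exhaust_8[of i] by (auto simp: vec_to_oct_def vector_def)
  then show ?thesis by (simp add: vec_eq_iff)
qed

definition oct_matrix :: "(oct \<Rightarrow>\<^sub>L oct) \<Rightarrow> real^8^8" where
  "oct_matrix g = matrix (\<lambda>v. oct_to_vec (g (vec_to_oct v)))"

definition SO8 :: "(oct \<Rightarrow>\<^sub>L oct) set" where
  "SO8 = {g. orthogonal_transformation (blinfun_apply g) \<and> det (oct_matrix g) = 1}"


section \<open>The form \<open>B\<close>, the variety \<open>V\<close> and the group \<open>G\<close>\<close>

fun B :: "oct \<Rightarrow> oct \<Rightarrow> quat" where
  "B (x, y) (x', y') = x * qcnj x' + y' * qcnj y"

definition S7 :: "oct set" where "S7 = sphere 0 1"

definition V :: "(oct \<times> oct) set" where
  "V = {(q, q') \<in> S7 \<times> S7. B q q' = 0}"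

definition stabilizes :: "(oct \<Rightarrow>\<^sub>L oct) set \<Rightarrow> (oct \<times> oct) set \<Rightarrow> bool" where
  "stabilizes H W \<longleftrightarrow> (\<forall>g\<in>H. (\<lambda>(q, q'). (g q, g q')) ` W = W)"

definition G :: "(oct \<Rightarrow>\<^sub>L oct) set" where
  "G = {g \<in> SO8. \<forall>q q'. B q q' = 0 \<longleftrightarrow> B (g q) (g q') = 0}"

definition G0 :: "(oct \<Rightarrow>\<^sub>L oct) set" where
  "G0 = connected_component_set G id_blinfun"

end

theory Submission
  imports Defs
begin

text \<open>
  The twists \<open>(x, y) \<mapsto> (c x a, c y b)\<close> with unit quaternions \<open>a, b, c\<close> satisfy
  \<open>B (g q) (g q') = c (B q q') c\<^sup>-\<^sup>1\<close>, and \<open>J\<close>, the left multiplication by \<open>(0, 1)\<close>, satisfies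
  \<open>B (J q) (J q') = conj (B q q')\<close>.  Both preserve the zero set of \<open>B\<close>; the core of the proof is
  that, together, they generate every linear map that preserves \<open>V\<close>.

  A linear map preserving \<open>V\<close> maps unit vectors to unit vectors, because every unit vector is
  part of a pair in \<open>V\<close>; so it is orthogonal, and by scaling it preserves the relation
  \<open>B q q' = 0\<close> for all vectors (\<open>zero_pattern_of_stabilizer\<close>).  The axes \<open>H \<times> 0\<close> and \<open>0 \<times> H\<close> can be
  recognised from this relation alone (\<open>axis_like_iff\<close>), so the map permutes them, and after
  multiplying with \<open>J\<close> it is block diagonal.  Feeding a few special zeros of \<open>B\<close> into a block
  diagonal map shows that its two blocks are, up to right multiplications, the same ring
  automorphism of the quaternions (\<open>multiplicative_of_zero_pattern\<close>), which is inner by the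
  Skolem-Noether theorem (\<open>conjugating_quat\<close>).  Hence the map is a twist or \<open>J\<close> times a twist
  (\<open>zero_pattern_structure\<close>).  All of these have determinant 1, since they are squares of
  orthogonal maps or products of such squares.

  So \<open>G\<close> is the stabilizer of \<open>V\<close> in the general linear group.  It is the disjoint union of
  the set of twists, which is compact and connected as a continuous image of
  \<open>S3 \<times> S3 \<times> S3\<close>, and its translate by \<open>J\<close>.  This identifies the identity component.  The
  form \<open>B\<close> is surjective, so \<open>\<theta> g\<close> is determined by \<open>B (g q) (g q') = \<theta> g (B q q')\<close>, which
  makes \<open>\<theta>\<close> a morphism; its values are the inner automorphisms and their compositions with
  conjugation.  These two families are the whole of \<open>O3\<close> (\<open>O3_cases\<close>) and are told apart by
  the determinant.
\<close>

section \<open>Quaternions\<close>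

lemma qcnj_sel [simp]:
  "qRe (qcnj x) = qRe x" "qI (qcnj x) = - qI x" "qJ (qcnj x) = - qJ x" "qK (qcnj x) = - qK x"
  by (simp_all add: qcnj.rep_eq)

lemma qcnj_mult: "qcnj (x * y) = qcnj y * qcnj x"
  by (simp add: quat_eq_iff algebra_simps)

lemma qcnj_qcnj [simp]: "qcnj (qcnj x) = x"
  by (simp add: quat_eq_iff)

lemma qcnj_one [simp]: "qcnj 1 = 1"
  by (simp add: quat_eq_iff)

lemma qcnj_eq_0_iff [simp]: "qcnj x = 0 \<longleftrightarrow> x = 0"
  by (simp add: quat_eq_iff)

lemma mult_qcnj: "x * qcnj x = of_real ((norm x)\<^sup>2)" "qcnj x * x = of_real ((norm x)\<^sup>2)"
  by (simp_all add: quat_eq_iff norm_quat_def inner_quat_def of_real_def power2_eq_square)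

lemma S3_iff: "x \<in> S3 \<longleftrightarrow> norm x = 1"
  by (simp add: S3_def)

lemma S3_mult_qcnj [simp]:
  assumes "x \<in> S3" shows "x * qcnj x = 1" "qcnj x * x = 1"
  using assms by (simp_all add: mult_qcnj S3_iff)

lemma S3_cancel [simp]:
  assumes "x \<in> S3" shows "x * (qcnj x * y) = y" "qcnj x * (x * y) = y"
  using S3_mult_qcnj[OF assms] by (simp_all flip: mult.assoc)

lemma S3_inverse: "x \<in> S3 \<Longrightarrow> inverse x = qcnj x"
  by (metis S3_mult_qcnj(1) inverse_unique)

lemma norm_qcnj [simp]: "norm (qcnj x) = norm x"
  by (simp add: norm_quat_def inner_quat_def)

lemma S3_closed:
  "1 \<in> S3" "x \<in> S3 \<Longrightarrow> y \<in> S3 \<Longrightarrow> x * y \<in> S3" "x \<in> S3 \<Longrightarrow> qcnj x \<in> S3"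
  by (simp_all add: S3_iff norm_mult)

lemma inner_quat_Re: "inner x y = qRe (x * qcnj y)"
  by (simp add: inner_quat_def)

lemma qRe_mult_commute: "qRe (x * y) = qRe (y * x)"
  by simp

lemma inner_conj:
  assumes "c \<in> S3"
  shows "inner (c * x * qcnj c) (c * y * qcnj c) = inner x y"
proof -
  have "inner (c * x * qcnj c) (c * y * qcnj c) = qRe (c * (x * qcnj y * qcnj c))"
    using assms unfolding inner_quat_Re by (simp add: qcnj_mult mult.assoc)
  also have "\<dots> = qRe (x * qcnj y * qcnj c * c)"
    by (rule qRe_mult_commute)
  finally show ?thesis
    using assms by (simp only: inner_quat_Re mult.assoc S3_mult_qcnj mult_1_right)
qed

abbreviation "qi \<equiv> Quat 0 1 0 0"
abbreviation "qj \<equiv> Quat 0 0 1 0"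
abbreviation "qk \<equiv> Quat 0 0 0 1"

text \<open>
  Square roots let every rotation be written as a square, whose determinant is then
  automatically positive.  For \<open>a \<noteq> -1\<close> the root is the normalised bisector of 1 and \<open>a\<close>:
  \<open>(1 + a)\<^sup>2 = a (2 + 2 Re a)\<close> since \<open>a\<close> is a unit.
\<close>
lemma S3_sqrt:
  assumes "a \<in> S3" obtains s where "s \<in> S3" "a = s * s"
proof (cases "a = -1")
  case True
  have "qi \<in> S3" "qi * qi = -1"
    by (simp_all add: S3_iff norm_quat_def inner_quat_def quat_eq_iff)
  with True show ?thesis using that by metis
next
  case False
  define r where "r = norm (1 + a)"
  have r: "r > 0" using False by (simp add: r_def add_eq_0_iff eq_commute[of _ a])
  have 1: "inner a a = 1" using assms by (simp add: S3_iff norm_eq_1)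
  have r2: "r * r = 2 + 2 * qRe a"
    using 1 unfolding r_def power2_eq_square[symmetric] power2_norm_eq_inner
    by (simp add: inner_quat_def algebra_simps)
  have sq: "(1 + a) * (1 + a) = (r * r) *\<^sub>R a"
    using 1 unfolding r2 by (auto simp: quat_eq_iff inner_quat_def algebra_simps)
  define s where "s = (1 / r) *\<^sub>R (1 + a)"
  show ?thesis
  proof
    show "s \<in> S3" using r by (simp add: s_def S3_iff flip: r_def)
    show "a = s * s" using r by (simp add: s_def sq)
  qed
qed

lemma DIM_quat: "DIM(quat) = 4"
  by (simp add: Basis_quat_def quat_eq_iff)

lemma linear_quat_eq:
  assumes "linear f" "linear g" "f 1 = g 1" "f qi = g qi" "f qj = g qj" "f qk = g qk"
  shows "f x = g x"
proof -
  have "f = g" using assms by (intro linear_eq_stdbasis) (auto simp: Basis_quat_def)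
  then show ?thesis by simp
qed

section \<open>The isometries of the quaternions fixing 1\<close>

text \<open>
  The Skolem-Noether theorem for the quaternions.  The map sending \<open>1, i, j, k\<close> to
  \<open>1, u, v, u v\<close> is an automorphism \<open>f\<close>; averaging any \<open>h\<close> over the quaternion group gives
  \<open>C h = \<Sum> f(e) h e\<^sup>-\<^sup>1\<close> (sum over \<open>e = 1, i, j, k\<close>), which intertwines \<open>f\<close> with the
  identity.  Some \<open>C h\<close> is nonzero because \<open>\<Sum> C(e) e\<^sup>-\<^sup>1 = 4\<close>: the contributions of \<open>u\<close>, \<open>v\<close>
  and \<open>u v\<close> cancel.
\<close>
lemma conjugating_quat:
  fixes u v :: quat
  assumes uu: "u * u = -1" and vv: "v * v = -1" and uv: "v * u = - (u * v)"
  obtains c where "c \<in> S3" "u = c * qi * qcnj c" "v = c * qj * qcnj c" "u * v = c * qk * qcnj c"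
proof -
  define C where "C h = h - u * h * qi - v * h * qj - u * v * h * qk" for h
  have ijk: "qi * qi = -1" "qj * qj = -1" "qi * qj = qk" "qj * qi = - qk"
    "qk * qi = qj" "qk * qj = - qi" "qi * qk = - qj" "qj * qk = qi" "qk * qk = -1"
    by (simp_all add: quat_eq_iff)
  have uu': "u * (u * z) = - z" and vv': "v * (v * z) = - z" and uv': "v * (u * z) = - (u * (v * z))" for z
    using uu vv uv by (simp_all flip: mult.assoc)
  have Ci: "u * C h = C h * qi" and Cj: "v * C h = C h * qj" for h
    unfolding C_def by (simp_all add: right_diff_distrib left_diff_distrib mult.assoc ijk uu' vv' uv')
  have "C 1 - C qi * qi - C qj * qj - C qk * qk = 1 + 1 + 1 + 1"
    unfolding C_def by (simp add: ring_distribs mult.assoc ijk)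
  moreover have "(1 + 1 + 1 + 1 :: quat) \<noteq> 0"
    by (simp add: quat_eq_iff del: one_add_one)
  ultimately have "\<not> (\<forall>h. C h = 0)"
    by (metis diff_0_right mult_zero_left)
  then obtain h where h: "C h \<noteq> 0"
    by blast
  define c where "c = (1 / norm (C h)) *\<^sub>R C h"
  have c: "c \<in> S3" using h by (simp add: c_def S3_iff)
  have ci: "u * c = c * qi" and cj: "v * c = c * qj"
    by (simp_all add: c_def Ci Cj)
  have ck: "u * v * c = c * qk"
    by (metis ci cj ijk(3) mult.assoc)
  show ?thesis
    using that[OF c] by (metis c ci cj ck S3_mult_qcnj(1) mult.assoc mult_1_right)
qed

lemma linear_blinfun_apply: "linear (blinfun_apply f)"
  by (simp add: blinfun.bounded_linear_right bounded_linear.linear)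

lemma Int_quat_S3: "c \<in> S3 \<Longrightarrow> Int_quat c x = c * x * qcnj c"
  by (simp add: Int_quat_apply S3_inverse)

lemma Int_quat_qcnj: "c \<in> S3 \<Longrightarrow> Int_quat c o\<^sub>L qcnj = qcnj o\<^sub>L Int_quat c"
  by (rule blinfun_eqI) (simp add: Int_quat_S3 qcnj_mult mult.assoc)

lemma O3_iff: "f \<in> O3 \<longleftrightarrow> (\<forall>x y. inner (f x) (f y) = inner x y) \<and> f 1 = 1"
  by (simp add: O3_def O4_def orthogonal_transformation_def linear_blinfun_apply)

lemma qcnj_in_O3: "qcnj \<in> O3"
  by (simp add: O3_iff) (simp add: inner_quat_def)

lemma Int_quat_in_O3: "c \<in> S3 \<Longrightarrow> Int_quat c \<in> O3"
  by (simp add: O3_iff Int_quat_S3 inner_conj)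

lemma imaginary_mult_self: "qRe x = 0 \<Longrightarrow> inner x x = 1 \<Longrightarrow> x * x = -1"
  by (auto simp: quat_eq_iff inner_quat_def)

lemma imaginary_orthogonal_anticommute:
  "qRe x = 0 \<Longrightarrow> qRe y = 0 \<Longrightarrow> inner x y = 0 \<Longrightarrow> y * x = - (x * y)"
  by (simp add: quat_eq_iff inner_quat_def algebra_simps)

text \<open>
  An isometry fixing 1 sends \<open>i, j, k\<close> to an orthonormal imaginary triple \<open>u, v, w\<close>.  After
  conjugating \<open>u, v\<close> back to \<open>i, j\<close>, the third vector must be \<open>\<plusminus>k\<close>, that is \<open>w = \<plusminus>u v\<close>.  With the
  plus sign the isometry is an inner automorphism; with the minus sign the triple
  \<open>-u, -v, -w\<close> is positively oriented, so the isometry composed with conjugation is inner.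
\<close>
lemma O3_cases:
  assumes f: "f \<in> O3"
  obtains c where "c \<in> S3" "f = Int_quat c" | c where "c \<in> S3" "f = Int_quat c o\<^sub>L qcnj"
proof -
  have inn: "inner (f x) (f y) = inner x y" and f1: "f 1 = 1" for x y
    using f by (auto simp: O3_iff)
  define u v w where uvw: "u = f qi" "v = f qj" "w = f qk"
  have re: "qRe u = 0" "qRe v = 0" "qRe w = 0"
    using inn[of qi 1] inn[of qj 1] inn[of qk 1] unfolding f1 uvw by (simp_all add: inner_quat_def)
  have on: "inner u u = 1" "inner v v = 1" "inner w w = 1" "inner u v = 0" "inner w u = 0" "inner w v = 0"
    unfolding uvw inn by (simp_all add: inner_quat_def)
  have rel: "u * u = -1" "v * v = -1" "v * u = - (u * v)"
    using re on by (simp_all add: imaginary_mult_self imaginary_orthogonal_anticommute)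
  obtain c where c: "c \<in> S3" "u = c * qi * qcnj c" "v = c * qj * qcnj c" "u * v = c * qk * qcnj c"
    using conjugating_quat[OF rel] .
  \<comment> \<open>The frame \<open>u, v, w\<close> conjugated back, so that \<open>u, v\<close> become \<open>i, j\<close>.\<close>
  define t where "t = qcnj c * w * c"
  have w: "w = c * t * qcnj c" using c(1) by (simp add: t_def mult.assoc)
  have t_perp: "inner t 1 = 0" "inner t qi = 0" "inner t qj = 0" "inner t t = 1"
  proof -
    have t: "inner t x = inner w (c * x * qcnj c)" for x
      using inner_conj[OF c(1), of t x] by (simp only: w)
    show "inner t qi = 0" "inner t qj = 0"
      unfolding t c(2,3)[symmetric] by (fact on)+
    show "inner t t = 1"
      unfolding t[of t] w[symmetric] by (fact on)
    show "inner t 1 = 0"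
      unfolding t mult_1_right S3_mult_qcnj(1)[OF c(1)] using re(3) by (simp add: inner_quat_def)
  qed
  then have "t = qk \<or> t = - qk"
    by (auto simp: inner_quat_def quat_eq_iff square_eq_1_iff)
  then consider "w = u * v" | "w = - (u * v)"
    using w c(4) by auto
  then show ?thesis
  proof cases
    case 1
    have "f x = Int_quat c x" for x
      by (rule linear_quat_eq[of f "Int_quat c"])
        (use c 1 f1 in \<open>simp_all add: linear_blinfun_apply Int_quat_S3 flip: uvw\<close>)
    then show ?thesis using that(1)[OF c(1)] by (metis blinfun_eqI)
  next
    case 2
    have rel': "(-u) * (-u) = -1" "(-v) * (-v) = -1" "(-v) * (-u) = - ((-u) * (-v))" using rel by simp_all
    obtain d where d: "d \<in> S3" "-u = d * qi * qcnj d" "-v = d * qj * qcnj d" "(-u) * (-v) = d * qk * qcnj d"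
      using conjugating_quat[OF rel'] .
    have cn: "qcnj qi = - qi" "qcnj qj = - qj" "qcnj qk = - qk" by (simp_all add: quat_eq_iff)
    have "f x = (Int_quat d o\<^sub>L qcnj) x" for x
      by (rule linear_quat_eq[of f "Int_quat d o\<^sub>L qcnj"])
        (use d 2 f1 in \<open>simp_all add: linear_blinfun_apply Int_quat_S3 cn
          minus_equation_iff[of _ "_ * _"] flip: uvw\<close>)
    then show ?thesis using that(2)[OF d(1)] by (metis blinfun_eqI)
  qed
qed

lemma det_Int:
  assumes "c \<in> S3" shows "det (Im_matrix (Int_quat c)) = 1"
proof -
  have "det (Im_matrix (Int_quat c)) = (inner c c) ^ 3"
    using assms unfolding Im_matrix_def matrix_def det_3 inner_quat_def
    by (simp add: Int_quat_S3 axis_def Let_def, algebra)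
  then show ?thesis using assms by (simp add: S3_iff norm_eq_1)
qed

text \<open>
  Conjugation is minus the identity on the imaginary quaternions.
\<close>
lemma Im_matrix_qcnj: "Im_matrix (f o\<^sub>L qcnj) = - Im_matrix f"
proof -
  have "f (qcnj (Quat 0 a b c)) = - f (Quat 0 a b c)" for a b c
  proof -
    have "qcnj (Quat 0 a b c) = - Quat 0 a b c" by (simp add: quat_eq_iff)
    then show ?thesis by (simp add: blinfun.minus_right)
  qed
  then show ?thesis
    by (simp add: Im_matrix_def matrix_def vec_eq_iff forall_3 Let_def)
qed

lemma Im_matrix_id: "Im_matrix id_blinfun = mat 1"
  by (simp add: Im_matrix_def matrix_def vec_eq_iff forall_3 Let_def axis_def mat_def)

lemma id_compose [simp]: "id_blinfun o\<^sub>L f = f" "f o\<^sub>L id_blinfun = f"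
  by (auto intro!: blinfun_eqI)

lemma Im_matrix_qcnj_eq: "Im_matrix qcnj = - mat 1"
  using Im_matrix_qcnj[of id_blinfun] by (simp add: Im_matrix_id)

lemma Int_quat_SO3: "c \<in> S3 \<Longrightarrow> Int_quat c \<in> SO3"
  by (simp add: SO3_def Int_quat_in_O3 det_Int)

lemma O3_comp: "f \<in> O3 \<Longrightarrow> g \<in> O3 \<Longrightarrow> f o\<^sub>L g \<in> O3"
  by (simp add: O3_iff)

lemma det_uminus_3: "det (- A :: real^3^3) = - det A"
  by (simp add: det_3)

lemma Int_quat_qcnj_O3_minus: "c \<in> S3 \<Longrightarrow> Int_quat c o\<^sub>L qcnj \<in> O3_minus"
  by (simp add: O3_minus_def O3_comp Int_quat_in_O3 qcnj_in_O3 Im_matrix_qcnj det_uminus_3 det_Int)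

section \<open>The form \<open>B\<close> and the twists\<close>

lemma B_scaleR: "B (r *\<^sub>R p) (s *\<^sub>R q) = (r * s) *\<^sub>R B p q"
  by (cases p; cases q) (simp add: blinfun.scaleR_right scaleR_right_distrib mult.commute)

lemma B_commute: "B q p = qcnj (B p q)"
  by (cases p; cases q) (simp add: qcnj_mult blinfun.add_right)

lemma B_zero [simp]: "B 0 q = 0" "B q 0 = 0"
  by (cases q; simp add: zero_prod_def)+

abbreviation (input) twist :: "quat \<Rightarrow> quat \<Rightarrow> quat \<Rightarrow> oct \<Rightarrow>\<^sub>L oct" where
  "twist a b c \<equiv> Diag (Rmul a o\<^sub>L Lmul c) (Rmul b o\<^sub>L Lmul c)"

abbreviation (input) J :: "oct \<Rightarrow>\<^sub>L oct" where
  "J \<equiv> oct_Lmul E_down"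

definition Twists :: "(oct \<Rightarrow>\<^sub>L oct) set" where
  "Twists = {twist a b c | a b c. a \<in> S3 \<and> b \<in> S3 \<and> c \<in> S3}"

lemma twist_in_Twists: "a \<in> S3 \<Longrightarrow> b \<in> S3 \<Longrightarrow> c \<in> S3 \<Longrightarrow> twist a b c \<in> Twists"
  unfolding Twists_def by blast

lemma Diag_apply [simp]: "Diag A D (x, y) = (A x, D y)"
  by (simp add: Diag.rep_eq)

lemma twist_apply: "twist a b c (x, y) = (c * x * a, c * y * b)"
  by simp

lemma J_apply: "J (x, y) = (- y, x)"
  by (rule oct_Lmul_E_down)

lemma B_J: "B (J q) (J q') = qcnj (B q q')"
  by (cases q; cases q') (simp add: J_apply qcnj_mult blinfun.add_right blinfun.minus_right)

lemma B_twist: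
  assumes "a \<in> S3" "b \<in> S3" "c \<in> S3"
  shows "B (twist a b c q) (twist a b c q') = Int_quat c (B q q')"
  using assms by (cases q; cases q') (simp add: Int_quat_S3 qcnj_mult mult.assoc distrib_left distrib_right)

section \<open>Determinants\<close>

lemma linear_vec_to_oct: "linear vec_to_oct"
  by (rule linearI) (simp_all add: vec_to_oct_def quat_eq_iff)

lemma UNIV_8: "(UNIV :: 8 set) = {1, 2, 3, 4, 5, 6, 7, 8}"
  using exhaust_8 by auto

lemma sum_8: "sum f (UNIV :: 8 set) = f 1 + f 2 + f 3 + f 4 + f 5 + f 6 + f 7 + f 8"
  unfolding UNIV_8 by (simp add: add.assoc)

lemma oct_to_vec_nth:
  "oct_to_vec (x, y) $ 1 = qRe x" "oct_to_vec (x, y) $ 2 = qI x" "oct_to_vec (x, y) $ 3 = qJ x"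
  "oct_to_vec (x, y) $ 4 = qK x" "oct_to_vec (x, y) $ 5 = qRe y" "oct_to_vec (x, y) $ 6 = qI y"
  "oct_to_vec (x, y) $ 7 = qJ y" "oct_to_vec (x, y) $ 8 = qK y"
  using vec_to_oct_oct_to_vec[of "(x, y)"]
  by (simp_all del: oct_to_vec.simps add: vec_to_oct_def quat_eq_iff)

lemma inner_oct_to_vec: "inner (oct_to_vec p) (oct_to_vec q) = inner p q"
  by (cases p; cases q)
    (simp del: oct_to_vec.simps add: inner_vec_def sum_8 oct_to_vec_nth inner_prod_def inner_quat_def)

lemma linear_oct_to_vec: "linear oct_to_vec"
proof (rule linearI)
  fix p q :: oct and r :: real
  have "vec_to_oct (oct_to_vec p + oct_to_vec q) = p + q" "vec_to_oct (r *\<^sub>R oct_to_vec q) = r *\<^sub>R q"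
    by (simp_all only: linear_add[OF linear_vec_to_oct] linear_scale[OF linear_vec_to_oct]
        vec_to_oct_oct_to_vec)
  from this[THEN arg_cong[where f = oct_to_vec]]
  show "oct_to_vec (p + q) = oct_to_vec p + oct_to_vec q" "oct_to_vec (r *\<^sub>R q) = r *\<^sub>R oct_to_vec q"
    by (simp_all only: oct_to_vec_vec_to_oct)
qed

text \<open>
  The map whose matrix is \<^const>\<open>oct_matrix\<close>.
\<close>
lemma linear_oct_rep: "linear (\<lambda>v. oct_to_vec (blinfun_apply g (vec_to_oct v)))"
  using linear_compose[OF linear_compose[OF linear_vec_to_oct linear_blinfun_apply[of g]] linear_oct_to_vec]
  by (simp add: o_def)

lemma oct_matrix_compose: "oct_matrix (g o\<^sub>L h) = oct_matrix g ** oct_matrix h"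
  unfolding oct_matrix_def
  using matrix_compose[OF linear_oct_rep[of h] linear_oct_rep[of g]]
  by (simp add: o_def vec_to_oct_oct_to_vec)

lemma det_oct_matrix_orthogonal:
  assumes "orthogonal_transformation (blinfun_apply g)"
  shows "det (oct_matrix g) = 1 \<or> det (oct_matrix g) = - 1"
proof -
  have "orthogonal_transformation (\<lambda>v. oct_to_vec (g (vec_to_oct v)))"
    unfolding orthogonal_transformation_def
  proof (intro conjI allI linear_oct_rep)
    fix v w :: "real^8"
    have "inner (g (vec_to_oct v)) (g (vec_to_oct w)) = inner (vec_to_oct v) (vec_to_oct w)"
      using assms by (simp only: orthogonal_transformation_def)
    then show "inner (oct_to_vec (g (vec_to_oct v))) (oct_to_vec (g (vec_to_oct w))) = inner v w"
      by (metis inner_oct_to_vec oct_to_vec_vec_to_oct)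
  qed
  then show ?thesis
    unfolding oct_matrix_def orthogonal_transformation_matrix by (auto dest!: det_orthogonal_matrix)
qed

text \<open>
  The determinant of an orthogonal map is \<open>\<plusminus>1\<close>, so a square has determinant 1.
\<close>
lemma square_in_SO8:
  assumes h: "orthogonal_transformation (blinfun_apply h)"
  shows "h o\<^sub>L h \<in> SO8"
proof -
  have "blinfun_apply (h o\<^sub>L h) = blinfun_apply h \<circ> blinfun_apply h" by auto
  then have "orthogonal_transformation (blinfun_apply (h o\<^sub>L h))"
    using orthogonal_transformation_compose[OF h h] by simp
  moreover have "det (oct_matrix (h o\<^sub>L h)) = 1"
    using det_oct_matrix_orthogonal[OF h] by (auto simp: oct_matrix_compose det_mul)
  ultimately show ?thesis by (simp add: SO8_def)
qed

lemma inner_eq_Re_B: "inner q q' = qRe (B q q')"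
  by (cases q; cases q') (simp add: inner_prod_def inner_quat_def)

lemma orthogonal_twist:
  assumes "a \<in> S3" "b \<in> S3" "c \<in> S3"
  shows "orthogonal_transformation (blinfun_apply (twist a b c))"
proof -
  have "inner (twist a b c q) (twist a b c q') = inner q q'" for q q'
  proof -
    have "qRe (Int_quat c z) = qRe z" for z
      using inner_conj[OF assms(3), of z 1] assms by (simp add: Int_quat_S3 inner_quat_def)
    then show ?thesis unfolding inner_eq_Re_B B_twist[OF assms] .
  qed
  then show ?thesis by (simp add: orthogonal_transformation_def linear_blinfun_apply
      del: blinfun_apply_blinfun_compose)
qed

text \<open>
  A twist by \<open>a, b, c\<close> is the square of the twist by square roots of \<open>a, b, c\<close>.
\<close>
lemma twist_in_SO8:
  assumes "a \<in> S3" "b \<in> S3" "c \<in> S3"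
  shows "twist a b c \<in> SO8"
proof -
  obtain a' b' c' where s: "a' \<in> S3" "b' \<in> S3" "c' \<in> S3" "a = a' * a'" "b = b' * b'" "c = c' * c'"
    using assms S3_sqrt by metis
  have "twist a b c = twist a' b' c' o\<^sub>L twist a' b' c'"
    by (rule blinfun_eqI) (auto simp: s mult.assoc)
  then show ?thesis using square_in_SO8[OF orthogonal_twist] s by metis
qed

text \<open>
  \<open>J\<close> is a complex structure, hence the square of the rotation \<open>(1 + J) / \<surd>2\<close>.
\<close>
lemma J_in_SO8: "J \<in> SO8"
proof -
  define k where "k = 1 / sqrt 2"
  have k2: "k * k = 1/2" "k * (k * t) = t / 2" "k * (2 * k) = 1" for t by (simp_all add: k_def)
  define F where "F = k *\<^sub>R (id_blinfun + J)"
  have F: "F (x, y) = (k *\<^sub>R (x - y), k *\<^sub>R (x + y))" for x y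
    by (simp add: F_def J_apply blinfun.add_left blinfun.scaleR_left)
  have "J (x, y) = (F o\<^sub>L F) (x, y)" for x y
    by (simp add: F J_apply quat_eq_iff right_diff_distrib distrib_left k2)
  then have "J = F o\<^sub>L F"
    by (intro blinfun_eqI) (metis surj_pair)
  moreover have "orthogonal_transformation (blinfun_apply F)"
  proof -
    have "inner (F (x, y)) (F (x', y')) = inner (x, y) (x', y')" for x y x' y'
      by (simp add: F inner_prod_def inner_add_left inner_add_right
        inner_diff_left inner_diff_right right_diff_distrib distrib_left k2)
    then show ?thesis by (simp add: orthogonal_transformation_def linear_blinfun_apply)
  qed
  ultimately show ?thesis using square_in_SO8 by metis
qed

lemma SO8_comp: "g \<in> SO8 \<Longrightarrow> h \<in> SO8 \<Longrightarrow> g o\<^sub>L h \<in> SO8"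
  by (simp add: SO8_def oct_matrix_compose det_mul orthogonal_transformation_def linear_blinfun_apply
    del: split_paired_All)

section \<open>Rigidity of the zero set of \<open>B\<close>\<close>

text \<open>
  The nonzero points of the two coordinate axes \<open>H \<times> 0\<close> and \<open>0 \<times> H\<close> are singled out by a condition
  that mentions only the relation \<open>B q q' = 0\<close>: all nonzero points \<open>p\<close> orthogonal to \<open>q\<close> have
  the same orthogonal space.  A bijection preserving the relation therefore preserves it.
\<close>
definition axis_like :: "oct \<Rightarrow> bool" where
  "axis_like q \<longleftrightarrow> (\<forall>p r s. p \<noteq> 0 \<longrightarrow> B q p = 0 \<longrightarrow> B q r = 0 \<longrightarrow> B p s = 0 \<longrightarrow> B r s = 0)"

lemma axis_likeI:
  "(\<And>p r s. p \<noteq> 0 \<Longrightarrow> B q p = 0 \<Longrightarrow> B q r = 0 \<Longrightarrow> B p s = 0 \<Longrightarrow> B r s = 0) \<Longrightarrow> axis_like q"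
  unfolding axis_like_def by blast

lemma axis_likeD:
  "axis_like q \<Longrightarrow> p \<noteq> 0 \<Longrightarrow> B q p = 0 \<Longrightarrow> B q r = 0 \<Longrightarrow> B p s = 0 \<Longrightarrow> B r s = 0"
  unfolding axis_like_def by blast

text \<open>
  For \<open>x, y \<noteq> 0\<close> the first argument, as \<open>m\<close> varies, parametrises the space orthogonal to
  \<open>(x, y)\<close>; the second one, as \<open>n\<close> varies, the space orthogonal to the first for \<open>m = 1\<close>.  The
  two families are orthogonal to each other only as far as \<open>m\<close> and \<open>n\<close> commute.
\<close>
lemma B_orthogonal_family:
  "B (- ((norm y)\<^sup>2 *\<^sub>R (qcnj m * x)), (norm x)\<^sup>2 *\<^sub>R (m * y)) (qcnj n * x, n * y)
    = ((norm x)\<^sup>2 * (norm y)\<^sup>2) *\<^sub>R (n * qcnj m - qcnj m * n)"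
proof -
  have "qcnj m * x * (qcnj x * n) = (norm x)\<^sup>2 *\<^sub>R (qcnj m * n)"
    using mult_qcnj(1)[of x]
    by (metis (no_types) mult.assoc mult_scaleR_left mult_scaleR_right of_real_def mult_1_left)
  moreover have "n * y * (qcnj y * qcnj m) = (norm y)\<^sup>2 *\<^sub>R (n * qcnj m)"
    using mult_qcnj(1)[of y]
    by (metis (no_types) mult.assoc mult_scaleR_left mult_scaleR_right of_real_def mult_1_left)
  ultimately show ?thesis
    by (simp add: qcnj_mult blinfun.scaleR_right mult.commute scaleR_diff_right)
qed

text \<open>
  Off the axes, noncommuting parameters such as \<open>i\<close> and \<open>j\<close> in the two orthogonal families
  violate the condition.
\<close>
lemma axis_like_iff:
  assumes "(x, y) \<noteq> (0 :: oct)"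
  shows "axis_like (x, y) \<longleftrightarrow> x = 0 \<or> y = 0"
proof
  assume ax: "axis_like (x, y)"
  show "x = 0 \<or> y = 0"
  proof (rule ccontr)
    assume ne: "\<not> (x = 0 \<or> y = 0)"
    define P where "P m = (- ((norm y)\<^sup>2 *\<^sub>R (qcnj m * x)), (norm x)\<^sup>2 *\<^sub>R (m * y))" for m
    have fam: "B (P m) (qcnj n * x, n * y) = ((norm x)\<^sup>2 * (norm y)\<^sup>2) *\<^sub>R (n * qcnj m - qcnj m * n)" for m n
      unfolding P_def by (rule B_orthogonal_family)
    have "B (x, y) (P m) = 0" for m
      using fam[of m 1] B_commute[of "(x,y)" "P m"] by simp
    moreover have "P 1 \<noteq> 0" using ne by (simp add: P_def zero_prod_def)
    moreover have "B (P 1) (qcnj qj * x, qj * y) = 0" using fam[of 1 qj] by simp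
    ultimately have "B (P qi) (qcnj qj * x, qj * y) = 0"
      using ax unfolding axis_like_def by blast
    then have "qj * qcnj qi - qcnj qi * qj = 0" using fam[of qi qj] ne by simp
    then show False by (simp add: quat_eq_iff)
  qed
next
  assume "x = 0 \<or> y = 0"
  then show "axis_like (x, y)" using assms
    by (auto simp: axis_like_def zero_prod_def)
qed

lemma mult_S3_qcnj: "s \<in> S3 \<Longrightarrow> (x * s) * qcnj (y * s) = x * qcnj y"
  by (simp add: qcnj_mult mult.assoc)

text \<open>
  After right translation \<open>A\<close> and \<open>D\<close> fix 1.  Write \<open>f, h\<close> for the translated maps.  The zero
  \<open>(x, 1), (1, -x)\<close> gives \<open>f = h\<close>, and the zero \<open>(x, 1), (x', - x \<cdot> conj x')\<close> gives
  \<open>f x \<cdot> conj (f x') = f (x \<cdot> conj x')\<close>.  With \<open>x = 1\<close> this says that \<open>f\<close> commutes with conjugation,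
  hence \<open>f\<close> is multiplicative, and it is inner by \<open>conjugating_quat\<close>.
\<close>
lemma multiplicative_of_zero_pattern:
  assumes lin: "linear A" "linear D" and n1: "norm (A 1) = 1" "norm (D 1) = 1"
    and zero: "\<And>x y x' y'. B (x, y) (x', y') = 0 \<Longrightarrow> B (A x, D y) (A x', D y') = 0"
  obtains c where "c \<in> S3" "\<And>x. A x = c * x * qcnj c * A 1" "\<And>y. D y = c * y * qcnj c * D 1"
proof -
  have S: "A 1 \<in> S3" "D 1 \<in> S3" using n1 by (simp_all add: S3_iff)
  define f where "f x = A x * qcnj (A 1)" for x
  define h where "h y = D y * qcnj (D 1)" for y
  have Af: "A x = f x * A 1" and Dh: "D y = h y * D 1" for x y
    using S by (simp_all add: f_def h_def mult.assoc)
  have linf: "linear f" "linear h" unfolding f_def h_def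
    using lin by (auto intro!: linearI simp: linear_add linear_scale distrib_right)
  have f1: "f 1 = 1" "h 1 = 1" using S by (simp_all add: f_def h_def)
  have z: "f x * qcnj (f x') + h y' * qcnj (h y) = 0" if "x * qcnj x' + y' * qcnj y = 0" for x y x' y'
  proof -
    have "A x * qcnj (A x') = f x * qcnj (f x')" "D y' * qcnj (D y) = h y' * qcnj (h y)"
      using S by (metis Af Dh mult_S3_qcnj)+
    with zero[of x y x' y'] that show ?thesis by simp
  qed
  have hf: "h x = f x" for x
    using z[of x 1 "-x" 1] linear_neg[OF linf(2), of x] by (simp add: f1)
  have zf: "f x * qcnj (f x') = f (x * qcnj x')" for x x'
    using z[of x x' "- (x * qcnj x')" 1] linear_neg[OF linf(1), of "x * qcnj x'"] by (simp add: f1 hf)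
  have mult: "f (x * y) = f x * f y" for x y
    using zf[of x "qcnj y"] zf[of 1 "qcnj y"] by (simp add: f1)
  have fn: "f (- x) = - f x" for x by (rule linear_neg[OF linf(1)])
  have ij: "qi * qi = -1" "qj * qj = -1" "qj * qi = - (qi * qj)" "qi * qj = qk" by (simp_all add: quat_eq_iff)
  have rel: "f qi * f qi = -1" "f qj * f qj = -1" "f qj * f qi = - (f qi * f qj)"
    unfolding mult[symmetric] fn[symmetric] ij(1-3) by (simp_all add: fn f1)
  obtain c where c: "c \<in> S3" "f qi = c * qi * qcnj c" "f qj = c * qj * qcnj c" "f qi * f qj = c * qk * qcnj c"
    using conjugating_quat[OF rel] .
  have k: "f qk = c * qk * qcnj c" using c(4) mult[of qi qj] by (simp add: ij)
  have fc: "f x = Int_quat c x" for x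
    by (rule linear_quat_eq[OF linf(1) linear_blinfun_apply]) (use c k f1 in \<open>simp_all add: Int_quat_S3\<close>)
  show ?thesis
    by (rule that[OF c(1)]) (metis Af Dh hf fc Int_quat_S3 c(1))+
qed

text \<open>
  The maps to be classified.  They turn out to be the elements of \<^const>\<open>G\<close>, because the
  classification yields only twists and their products with \<open>J\<close>, all of determinant 1.
\<close>
locale zero_pattern =
  fixes g :: "oct \<Rightarrow>\<^sub>L oct"
  assumes orth: "orthogonal_transformation (blinfun_apply g)"
    and zero: "\<And>q q'. B (g q) (g q') = 0 \<longleftrightarrow> B q q' = 0"
begin

lemma norm_g: "norm (g q) = norm q"
  using orth by (simp add: orthogonal_transformation_norm)

lemma g_eq_0: "g q = 0 \<longleftrightarrow> q = 0"
  by (metis norm_g norm_eq_zero)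

lemma axis_like_g: "axis_like (g q) \<longleftrightarrow> axis_like q"
proof
  assume ax: "axis_like (g q)"
  show "axis_like q"
  proof (rule axis_likeI)
    fix p r s
    assume "p \<noteq> 0" "B q p = 0" "B q r = 0" "B p s = 0"
    then show "B r s = 0"
      using axis_likeD[OF ax, of "g p" "g r" "g s"] by (simp add: zero g_eq_0)
  qed
next
  assume ax: "axis_like q"
  show "axis_like (g q)"
  proof (rule axis_likeI)
    fix p r s
    assume *: "p \<noteq> 0" "B (g q) p = 0" "B (g q) r = 0" "B p s = 0"
    have "surj (blinfun_apply g)" using orth by (rule orthogonal_transformation_surj)
    then obtain p' r' s' where "p = g p'" "r = g r'" "s = g s'"
      by (meson surjD)
    with * show "B r s = 0" using axis_likeD[OF ax, of p' r' s'] by (simp add: zero g_eq_0)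
  qed
qed

lemma axis_image:
  assumes "fst q = 0 \<or> snd q = 0" shows "fst (g q) = 0 \<or> snd (g q) = 0"
proof (cases "q = 0")
  case False
  then have "g q \<noteq> 0" by (simp only: g_eq_0 not_False_eq_True)
  then show ?thesis
    using False assms axis_like_g[of q] axis_like_iff[of "fst q" "snd q"]
      axis_like_iff[of "fst (g q)" "snd (g q)"]
    unfolding prod.collapse by blast
qed (simp add: blinfun.zero_right)

lemma g_split: "g (x, y) = g (x, 0) + g (0, y)"
  by (simp flip: blinfun.add_right)

text \<open>
  A linear image of an axis lies in the union of the two axes, hence in one of them: a vector
  on each axis would have its sum on neither.  The other axis is orthogonal to the first, so
  its image lies in the other one.
\<close>
lemma axes_cases:
  obtains "\<And>x. snd (g (x, 0)) = 0" "\<And>y. fst (g (0, y)) = 0"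
        | "\<And>x. fst (g (x, 0)) = 0" "\<And>y. snd (g (0, y)) = 0"
proof -
  have ax: "fst (g (x, 0)) = 0 \<or> snd (g (x, 0)) = 0" for x
    by (rule axis_image) simp
  have "(\<forall>x. snd (g (x, 0)) = 0) \<or> (\<forall>x. fst (g (x, 0)) = 0)"
  proof (rule ccontr)
    assume "\<not> ?thesis"
    then obtain x x' where ne: "snd (g (x, 0)) \<noteq> 0" "fst (g (x', 0)) \<noteq> 0" by blast
    have "g (x + x', 0) = g (x, 0) + g (x', 0)" by (simp flip: blinfun.add_right)
    with ax[of "x + x'"] ax[of x] ax[of x'] ne show False by simp
  qed
  then consider "\<forall>x. snd (g (x, 0)) = 0" | "\<forall>x. fst (g (x, 0)) = 0" by blast
  then show ?thesis
  proof cases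
    case 1
    obtain u where u: "g (1, 0) = (u, 0)" using 1 by (metis prod.collapse)
    then have "u \<noteq> 0" using g_eq_0[of "(1, 0)"] by (auto simp: zero_prod_def)
    moreover have "B (g (1, 0)) (g (0, y)) = 0" for y by (simp only: zero) simp
    ultimately have "fst (g (0, y)) = 0" for y
      unfolding u by (cases "g (0, y)") (metis B.simps add_0_right fst_conv mult_eq_0_iff
          mult_zero_right qcnj_eq_0_iff)
    with 1 that(1) show ?thesis by blast
  next
    case 2
    obtain u where u: "g (1, 0) = (0, u)" using 2 by (metis prod.collapse)
    then have "u \<noteq> 0" using g_eq_0[of "(1, 0)"] by (auto simp: zero_prod_def)
    moreover have "B (g (1, 0)) (g (0, y)) = 0" for y by (simp only: zero) simp
    ultimately have "snd (g (0, y)) = 0" for y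
      unfolding u by (cases "g (0, y)") (metis B.simps add_0_left snd_conv mult_eq_0_iff
          mult_zero_left qcnj_eq_0_iff)
    with 2 that(2) show ?thesis by blast
  qed
qed

lemma diagonal_in_Twists:
  assumes diag: "\<And>x. snd (g (x, 0)) = 0" "\<And>y. fst (g (0, y)) = 0"
  shows "g \<in> Twists"
proof -
  define A where "A x = fst (g (x, 0))" for x
  define D where "D y = snd (g (0, y))" for y
  have g0: "g (x, 0) = (A x, 0)" "g (0, y) = (0, D y)" for x y
    by (simp_all add: A_def D_def prod_eq_iff diag)
  have g: "g (x, y) = (A x, D y)" for x y
    unfolding g_split[of x y] g0 by simp
  have lin: "linear A" "linear D"
  proof -
    have "g (x + x', y + y') = g (x, y) + g (x', y')" "g (r *\<^sub>R x, r *\<^sub>R y) = r *\<^sub>R g (x, y)" for x y x' y' r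
      by (simp_all flip: blinfun.add_right blinfun.scaleR_right)
    then show "linear A" "linear D" unfolding g by (auto intro!: linearI)
  qed
  have n1: "norm (A 1) = 1" "norm (D 1) = 1"
    using norm_g[of "(1, 0)"] norm_g[of "(0, 1)"] unfolding g0 by simp_all
  have z: "B (A x, D y) (A x', D y') = 0" if "B (x, y) (x', y') = 0" for x y x' y'
    using zero[of "(x, y)" "(x', y')"] that unfolding g by blast
  obtain c where c: "c \<in> S3" "\<And>x. A x = c * x * qcnj c * A 1" "\<And>y. D y = c * y * qcnj c * D 1"
    using multiplicative_of_zero_pattern[OF lin n1 z] by blast
  have "g (x, y) = twist (qcnj c * A 1) (qcnj c * D 1) c (x, y)" for x y
    unfolding g twist_apply by (metis c(2,3) mult.assoc)
  then have "g = twist (qcnj c * A 1) (qcnj c * D 1) c"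
    by (intro blinfun_eqI) (metis surj_pair)
  moreover have "qcnj c * A 1 \<in> S3" "qcnj c * D 1 \<in> S3"
    using c(1) n1 by (simp_all add: S3_iff norm_mult)
  ultimately show ?thesis using c(1) unfolding Twists_def by blast
qed

end

lemma J_J: "J (J q) = - q"
  by (cases q) (simp add: J_apply)

lemma uminus_twist: "- (twist a b c q) = twist (- a) (- b) c q"
  by (cases q) simp

lemma orthogonal_J: "orthogonal_transformation (blinfun_apply J)"
  using J_in_SO8 by (simp add: SO8_def)

text \<open>
  If the axes are exchanged, \<open>J\<close> exchanges them back; \<open>J\<^sup>-\<^sup>1 = -J\<close>, and the sign is absorbed by
  \<open>a\<close> and \<open>b\<close>.
\<close>
lemma zero_pattern_structure:
  assumes "zero_pattern g"
  shows "g \<in> Twists \<union> (\<lambda>t. J o\<^sub>L t) ` Twists"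
proof -
  interpret zero_pattern g by fact
  show ?thesis
  proof (rule axes_cases)
    assume "\<And>x. snd (g (x, 0)) = 0" "\<And>y. fst (g (0, y)) = 0"
    then show ?thesis using diagonal_in_Twists by blast
  next
    assume anti: "\<And>x. fst (g (x, 0)) = 0" "\<And>y. snd (g (0, y)) = 0"
    have "blinfun_apply (J o\<^sub>L g) = blinfun_apply J \<circ> blinfun_apply g" by auto
    then interpret Jg: zero_pattern "J o\<^sub>L g"
      using orthogonal_transformation_compose[OF orthogonal_J orth]
      by unfold_locales (simp_all add: B_J zero)
    have "snd (J p) = fst p" "fst (J p) = - snd p" for p by (cases p; simp add: J_apply)+
    then have "J o\<^sub>L g \<in> Twists"
      using anti by (intro Jg.diagonal_in_Twists) simp_all
    then obtain a b c where abc: "a \<in> S3" "b \<in> S3" "c \<in> S3" "J o\<^sub>L g = twist a b c"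
      unfolding Twists_def by blast
    have "g q = J (twist (- a) (- b) c q)" for q
      unfolding uminus_twist[symmetric] abc(4)[symmetric] by (simp add: blinfun.minus_right J_J)
    then have "g = J o\<^sub>L twist (- a) (- b) c"
      by (intro blinfun_eqI) simp
    moreover have "twist (- a) (- b) c \<in> Twists"
      using abc(1-3) by (intro twist_in_Twists) (simp_all add: S3_iff)
    ultimately show ?thesis by blast
  qed
qed

section \<open>The group \<open>G\<close>\<close>

lemma TwistsE:
  assumes "t \<in> Twists"
  obtains a b c where "a \<in> S3" "b \<in> S3" "c \<in> S3" "t = twist a b c"
  using assms unfolding Twists_def by blast

lemma Int_quat_eq_0_iff: "c \<in> S3 \<Longrightarrow> Int_quat c z = 0 \<longleftrightarrow> z = 0"
  by (auto simp: Int_quat_S3 S3_iff)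

lemma Twists_subset_G: "Twists \<subseteq> G"
proof
  fix t assume "t \<in> Twists"
  then show "t \<in> G"
    by (elim TwistsE) (simp only: G_def mem_Collect_eq twist_in_SO8 B_twist Int_quat_eq_0_iff simp_thms)
qed

lemma J_comp_in_G: "g \<in> G \<Longrightarrow> J o\<^sub>L g \<in> G"
  by (simp add: G_def SO8_comp J_in_SO8 B_J del: split_paired_All)

lemma zero_pattern_G: "g \<in> G \<Longrightarrow> zero_pattern g"
  by (simp add: G_def SO8_def zero_pattern_def del: split_paired_All)

lemma G_eq: "G = Twists \<union> (\<lambda>t. J o\<^sub>L t) ` Twists"
  using zero_pattern_structure zero_pattern_G Twists_subset_G J_comp_in_G by blast

lemma G_iff_zero_pattern: "g \<in> G \<longleftrightarrow> zero_pattern g"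
  using zero_pattern_structure zero_pattern_G G_eq by blast

section \<open>The stabilizer of \<open>V\<close>\<close>

lemma V_iff: "(q, q') \<in> V \<longleftrightarrow> norm q = 1 \<and> norm q' = 1 \<and> B q q' = 0"
  by (simp add: V_def S7_def)

text \<open>
  Every unit vector occurs as a component of a pair in \<^const>\<open>V\<close>; this is why preserving \<^const>\<open>V\<close>
  forces a linear map to be isometric.
\<close>
lemma exists_B_orthogonal: "\<exists>q'. q' \<noteq> 0 \<and> B q q' = 0"
proof (cases "fst q = 0 \<or> snd q = 0")
  case True
  then show ?thesis
  proof
    assume "fst q = 0"
    then show ?thesis by (intro exI[of _ "(1, 0)"]) (cases q, simp add: zero_prod_def)
  next
    assume "snd q = 0"
    then show ?thesis by (intro exI[of _ "(0, 1)"]) (cases q, simp add: zero_prod_def)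
  qed
next
  case False
  obtain x y where q: "q = (x, y)" by (cases q)
  let ?p = "(- ((norm y)\<^sup>2 *\<^sub>R x), (norm x)\<^sup>2 *\<^sub>R y)"
  have "B ?p q = 0"
    using B_orthogonal_family[of y 1 x 1] by (simp add: q)
  then have "B q ?p = 0" using B_commute[of q ?p] by simp
  moreover have "?p \<noteq> 0" using False by (simp add: q zero_prod_def)
  ultimately show ?thesis by blast
qed

text \<open>
  The zero relation for arbitrary vectors follows from the one for unit vectors by scaling.
\<close>
lemma zero_pattern_of_stabilizer:
  assumes inj: "inj (blinfun_apply g)" and img: "(\<lambda>(q, q'). (g q, g q')) ` V = V"
  shows "zero_pattern g"
proof
  have V: "(g q, g q') \<in> V \<longleftrightarrow> (q, q') \<in> V" for q q'
  proof
    assume "(g q, g q') \<in> V"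
    then have "(g q, g q') \<in> (\<lambda>(q, q'). (g q, g q')) ` V" by (simp only: img)
    then obtain p p' where "(p, p') \<in> V" "g q = g p" "g q' = g p'" by auto
    then show "(q, q') \<in> V" using inj by (metis injD)
  next
    assume "(q, q') \<in> V"
    then show "(g q, g q') \<in> V" using img by force
  qed
  have norm_1: "norm (g q) = 1" if q: "norm q = 1" for q
  proof -
    obtain p where p: "p \<noteq> 0" "B q p = 0" using exists_B_orthogonal by blast
    have "B q (p /\<^sub>R norm p) = 0" using B_scaleR[of 1 q "inverse (norm p)" p] p by simp
    then have "(q, p /\<^sub>R norm p) \<in> V" using p q by (simp add: V_iff)
    then show ?thesis using V[of q "p /\<^sub>R norm p"] by (simp add: V_iff)
  qed
  have norm_g: "norm (g q) = norm q" for q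
  proof (cases "q = 0")
    case False
    then have "norm (g (q /\<^sub>R norm q)) = 1" by (intro norm_1) simp
    with False show ?thesis by (simp add: blinfun.scaleR_right field_simps)
  qed (simp add: blinfun.zero_right)
  then show "orthogonal_transformation (blinfun_apply g)"
    by (simp only: orthogonal_transformation linear_blinfun_apply simp_thms)
  have sc: "B (p /\<^sub>R norm p) (q /\<^sub>R norm q) = 0 \<longleftrightarrow> B p q = 0" if "p \<noteq> 0" "q \<noteq> 0" for p q
    using that by (simp add: B_scaleR)
  fix q q'
  show "B (g q) (g q') = 0 \<longleftrightarrow> B q q' = 0"
  proof (cases "q = 0 \<or> q' = 0")
    case False
    then have ne: "q \<noteq> 0" "q' \<noteq> 0" "g q \<noteq> 0" "g q' \<noteq> 0" using norm_g by (metis norm_eq_zero)+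
    have "B (g q) (g q') = 0 \<longleftrightarrow> B (g (q /\<^sub>R norm q)) (g (q' /\<^sub>R norm q')) = 0"
      using sc[OF ne(3,4)] by (simp only: blinfun.scaleR_right norm_g)
    also have "\<dots> \<longleftrightarrow> B (q /\<^sub>R norm q) (q' /\<^sub>R norm q') = 0"
      using V[of "q /\<^sub>R norm q" "q' /\<^sub>R norm q'"] ne by (simp add: V_iff norm_1)
    also have "\<dots> \<longleftrightarrow> B q q' = 0" by (rule sc[OF ne(1,2)])
    finally show ?thesis .
  qed (auto simp: blinfun.zero_right)
qed

lemma carrier_GL: "g \<in> carrier GL \<longleftrightarrow> bij (blinfun_apply g)" and mult_GL: "f \<otimes>\<^bsub>GL\<^esub> h = f o\<^sub>L h"
  and one_GL: "\<one>\<^bsub>GL\<^esub> = id_blinfun"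
  by (simp_all add: GL_def)

lemma G_iff_stabilizes:
  "g \<in> G \<longleftrightarrow> g \<in> carrier GL \<and> (\<lambda>(q, q'). (g q, g q')) ` V = V"
proof
  assume "g \<in> G"
  then interpret zero_pattern g by (rule zero_pattern_G)
  have bij: "bij (blinfun_apply g)" using orth by (rule orthogonal_transformation_bij)
  have V: "(g q, g q') \<in> V \<longleftrightarrow> (q, q') \<in> V" for q q' by (simp add: V_iff norm_g zero)
  have "(\<lambda>(q, q'). (g q, g q')) ` V = V"
  proof (intro equalityI subsetI)
    fix v assume "v \<in> V"
    moreover obtain q q' where v: "v = (g q, g q')" using bij by (metis bij_pointE surj_pair)
    ultimately have "(q, q') \<in> V" using V by blast
    then show "v \<in> (\<lambda>(q, q'). (g q, g q')) ` V" unfolding v by (rule rev_image_eqI) simp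
  qed (auto simp only: V split: prod.splits)
  with bij show "g \<in> carrier GL \<and> (\<lambda>(q, q'). (g q, g q')) ` V = V" by (simp add: carrier_GL)
next
  assume "g \<in> carrier GL \<and> (\<lambda>(q, q'). (g q, g q')) ` V = V"
  then show "g \<in> G"
    by (simp add: G_iff_zero_pattern zero_pattern_of_stabilizer carrier_GL bij_is_inj)
qed

lemma subgroup_G: "subgroup G GL"
proof (rule group.subgroupI[OF group_GL])
  let ?act = "\<lambda>g::oct \<Rightarrow>\<^sub>L oct. \<lambda>(q, q'). (g q, g q')"
  have comp: "?act (f o\<^sub>L g) ` V = ?act f ` ?act g ` V" for f g
    by (simp add: image_image case_prod_beta)
  show "G \<subseteq> carrier GL" using G_iff_stabilizes by blast
  show "G \<noteq> {}" using G_iff_stabilizes[of id_blinfun] by (auto simp: carrier_GL case_prod_beta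
      bij_id[unfolded id_def])
  fix f assume f: "f \<in> G"
  show "f \<otimes>\<^bsub>GL\<^esub> g \<in> G" if "g \<in> G" for g
    using f that group.is_monoid[OF group_GL, THEN monoid.m_closed, of f g] comp[of f g]
    unfolding G_iff_stabilizes mult_GL by metis
  have fc: "f \<in> carrier GL" using f G_iff_stabilizes by blast
  let ?h = "inv\<^bsub>GL\<^esub> f"
  have "?h o\<^sub>L f = id_blinfun" using group.l_inv[OF group_GL fc] by (simp add: mult_GL one_GL)
  then have "?act ?h ` ?act f ` V = V" unfolding comp[symmetric] by (simp add: case_prod_beta)
  moreover have "?act f ` V = V" using f G_iff_stabilizes by blast
  ultimately have "?act ?h ` V = V" by simp
  then show "?h \<in> G" using group.inv_closed[OF group_GL fc] G_iff_stabilizes by blast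
qed

lemma stabilizes_G: "stabilizes G V"
  using G_iff_stabilizes by (simp add: stabilizes_def)

lemma stabilizer_subset_G: "subgroup H GL \<Longrightarrow> stabilizes H V \<Longrightarrow> H \<subseteq> G"
  using G_iff_stabilizes subgroup.subset unfolding stabilizes_def by blast

section \<open>The identity component\<close>

lemma coset_J: "J <#\<^bsub>GL\<^esub> H = (\<lambda>t. J o\<^sub>L t) ` H"
  by (auto simp: l_coset_def mult_GL)

text \<open>
  Twists preserve \<open>H \<times> 0\<close>, whereas \<open>J\<close> times a twist moves it to \<open>0 \<times> H\<close>.
\<close>
lemma Twists_disjoint: "Twists \<inter> (\<lambda>t. J o\<^sub>L t) ` Twists = {}"
proof -
  have "fst (t (1, 0)) \<noteq> 0" "fst ((J o\<^sub>L t) (1, 0)) = 0" if "t \<in> Twists" for t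
    using that by (auto elim!: TwistsE simp: J_apply S3_iff)
  then show ?thesis by blast
qed

text \<open>
  A block diagonal map is rewritten with the coordinate injections and projections, so that
  continuity in the operator norm reduces to that of composition and of multiplications.
\<close>
lemma continuous_twist: "continuous_on UNIV (\<lambda>(a, b, c). twist a b c)"
proof -
  define inl :: "quat \<Rightarrow>\<^sub>L oct" where "inl = Blinfun (\<lambda>x. (x, 0))"
  define inr :: "quat \<Rightarrow>\<^sub>L oct" where "inr = Blinfun (\<lambda>y. (0, y))"
  have "bounded_linear (\<lambda>x::quat. (x, 0::quat))" "bounded_linear (\<lambda>y::quat. (0::quat, y))"
    by (intro bounded_linear_Pair bounded_linear_ident bounded_linear_zero)+
  then have app: "inl x = (x, 0)" "inr x = (0, x)" for x
    by (simp_all add: inl_def inr_def bounded_linear_Blinfun_apply)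
  have "twist a b c = (inl o\<^sub>L (Rmul a o\<^sub>L Lmul c) o\<^sub>L fst_blinfun)
      + (inr o\<^sub>L (Rmul b o\<^sub>L Lmul c) o\<^sub>L snd_blinfun)" for a b c
    by (rule blinfun_eqI) (auto simp: app blinfun.add_left)
  then have "(\<lambda>(a, b, c). twist a b c) =
      (\<lambda>p. (inl o\<^sub>L (Rmul (fst p) o\<^sub>L Lmul (snd (snd p))) o\<^sub>L fst_blinfun)
         + (inr o\<^sub>L (Rmul (fst (snd p)) o\<^sub>L Lmul (snd (snd p))) o\<^sub>L snd_blinfun))"
    by (simp add: fun_eq_iff)
  then show ?thesis
    by (simp only:) (intro continuous_intros bounded_bilinear.continuous_on[OF bounded_bilinear_blinfun_compose]
      bounded_linear.continuous_on[OF bounded_linear_blinfun_mult_right]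
      bounded_linear.continuous_on[OF bounded_linear_blinfun_mult_left])
qed

lemma Twists_image: "Twists = (\<lambda>(a, b, c). twist a b c) ` (S3 \<times> S3 \<times> S3)"
  unfolding Twists_def by (auto simp: image_iff; blast)

lemma connected_Twists: "connected Twists"
proof -
  have "connected S3" unfolding S3_def by (rule connected_sphere) (simp add: DIM_quat)
  then show ?thesis unfolding Twists_image
    by (intro connected_continuous_image connected_Times continuous_on_subset[OF continuous_twist]) auto
qed

lemma compact_Twists: "compact Twists"
  unfolding Twists_image S3_def
  by (intro compact_continuous_image compact_Times compact_sphere continuous_on_subset[OF continuous_twist]) auto

lemma compact_J_Twists: "compact ((\<lambda>t. J o\<^sub>L t) ` Twists)"
  by (intro compact_continuous_image compact_Twists continuous_intros
      bounded_bilinear.continuous_on[OF bounded_bilinear_blinfun_compose])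

lemma id_in_Twists: "id_blinfun \<in> Twists"
proof -
  have "id_blinfun = twist 1 1 1" by (rule blinfun_eqI) auto
  then show ?thesis using twist_in_Twists[OF S3_closed(1) S3_closed(1) S3_closed(1)] by simp
qed

text \<open>
  \<open>G\<close> is the disjoint union of two compact sets, one of which is connected and contains the
  identity.
\<close>
lemma G0_eq: "G0 = Twists"
proof
  show "Twists \<subseteq> G0"
    unfolding G0_def by (rule connected_component_maximal[OF id_in_Twists connected_Twists Twists_subset_G])
  have con: "connected G0" and sub: "G0 \<subseteq> G"
    unfolding G0_def by (simp_all add: connected_component_subset)
  have "Twists \<inter> G0 = {} \<or> (\<lambda>t. J o\<^sub>L t) ` Twists \<inter> G0 = {}"
    using con Twists_disjoint sub compact_Twists compact_J_Twists
    by (intro connected_closedD) (auto simp: G_eq compact_imp_closed)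
  moreover have "id_blinfun \<in> Twists \<inter> G0"
    using id_in_Twists \<open>Twists \<subseteq> G0\<close> by blast
  ultimately show "G0 \<subseteq> Twists" using sub unfolding G_eq by blast
qed

section \<open>The morphism onto \<open>O3\<close>\<close>

text \<open>
  Since \<open>B (z, 0) (1, 0) = z\<close>, the identity \<open>B (g q) (g q') = \<theta> g (B q q')\<close> forces this formula.
\<close>
definition theta :: "(oct \<Rightarrow>\<^sub>L oct) \<Rightarrow> (quat \<Rightarrow>\<^sub>L quat)" where
  "theta g = Blinfun (\<lambda>z. B (g (z, 0)) (g (1, 0)))"

lemma theta_eqI:
  fixes g :: "oct \<Rightarrow>\<^sub>L oct" and f :: "quat \<Rightarrow>\<^sub>L quat"
  assumes "\<And>q q'. B (g q) (g q') = f (B q q')"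
  shows "theta g = f"
proof -
  have "(\<lambda>z. B (g (z, 0)) (g (1, 0))) = blinfun_apply f"
    unfolding assms by simp
  then show ?thesis by (simp add: theta_def blinfun_apply_inverse)
qed

lemma theta_twist: "a \<in> S3 \<Longrightarrow> b \<in> S3 \<Longrightarrow> c \<in> S3 \<Longrightarrow> theta (twist a b c) = Int_quat c"
  by (rule theta_eqI) (rule B_twist)

lemma theta_J_twist: "a \<in> S3 \<Longrightarrow> b \<in> S3 \<Longrightarrow> c \<in> S3 \<Longrightarrow> theta (J o\<^sub>L twist a b c) = qcnj o\<^sub>L Int_quat c"
  by (rule theta_eqI) (simp only: blinfun_apply_blinfun_compose[of J]
      blinfun_apply_blinfun_compose[of qcnj] B_J B_twist)

lemma G_cases:
  assumes "g \<in> G"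
  obtains a b c where "a \<in> S3" "b \<in> S3" "c \<in> S3" "g = twist a b c"
    | a b c where "a \<in> S3" "b \<in> S3" "c \<in> S3" "g = J o\<^sub>L twist a b c"
  using assms unfolding G_eq Twists_def by blast

lemma B_theta:
  assumes "g \<in> G" shows "B (g q) (g q') = theta g (B q q')"
  using assms
proof (cases rule: G_cases)
  case (1 a b c)
  then show ?thesis by (simp only: B_twist theta_twist)
next
  case (2 a b c)
  then show ?thesis by (simp only: theta_J_twist blinfun_apply_blinfun_compose[of J]
        blinfun_apply_blinfun_compose[of qcnj] B_J B_twist)
qed

lemma SO3_O3_minus_disjoint: "f \<in> SO3 \<Longrightarrow> f \<notin> O3_minus"
  by (simp add: SO3_def O3_minus_def)

lemma theta_Twists: "g \<in> Twists \<Longrightarrow> theta g \<in> SO3"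
  by (auto elim!: TwistsE simp add: theta_twist Int_quat_SO3)

lemma theta_J_Twists: "g \<in> Twists \<Longrightarrow> theta (J o\<^sub>L g) \<in> O3_minus"
  by (auto elim!: TwistsE simp add: theta_J_twist Int_quat_qcnj_O3_minus simp flip: Int_quat_qcnj)

text \<open>
  Multiplicativity is immediate from the uniqueness in \<open>theta_eqI\<close>.
\<close>
lemma theta_epi: "theta \<in> epi (GL\<lparr>carrier := G\<rparr>) O3_group"
proof -
  have "theta g \<in> O3" if "g \<in> G" for g
    using that theta_Twists theta_J_Twists unfolding G_eq SO3_def O3_minus_def by blast
  moreover have "theta (g o\<^sub>L h) = theta g o\<^sub>L theta h" if "g \<in> G" "h \<in> G" for g h
    using that by (intro theta_eqI) (simp add: B_theta)
  moreover have "f \<in> theta ` G" if "f \<in> O3" for f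
    using that
  proof (cases rule: O3_cases)
    case (1 c)
    have "twist 1 1 c \<in> G" "theta (twist 1 1 c) = f"
      using 1 S3_closed(1) Twists_subset_G twist_in_Twists theta_twist by blast+
    then show ?thesis by blast
  next
    case (2 c)
    have "J o\<^sub>L twist 1 1 c \<in> G"
      using 2 S3_closed(1) Twists_subset_G twist_in_Twists J_comp_in_G by blast
    moreover have "theta (J o\<^sub>L twist 1 1 c) = f"
      using 2 S3_closed(1) by (simp add: theta_J_twist Int_quat_qcnj)
    ultimately show ?thesis by blast
  qed
  ultimately show ?thesis
    by (auto simp: epi_def hom_def O3_group_def GL_def)
qed

lemma theta_preimages:
  "{g \<in> G. theta g \<in> SO3} = Twists" "{g \<in> G. theta g \<in> O3_minus} = (\<lambda>t. J o\<^sub>L t) ` Twists"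
  using theta_Twists theta_J_Twists SO3_O3_minus_disjoint unfolding G_eq by blast+

lemma twist_theta_form:
  assumes "g \<in> Twists" shows "\<exists>a\<in>S3. \<exists>b\<in>S3. g = Diag (Rmul a o\<^sub>L theta g) (Rmul b o\<^sub>L theta g)"
proof -
  from assms obtain a b c where abc: "a \<in> S3" "b \<in> S3" "c \<in> S3" "g = twist a b c" by (rule TwistsE)
  have "g = Diag (Rmul (c * a) o\<^sub>L theta g) (Rmul (c * b) o\<^sub>L theta g)"
    unfolding abc(4) theta_twist[OF abc(1-3)]
    using abc(3) by (intro blinfun_eqI) (auto simp: Int_quat_S3 mult.assoc)
  then show ?thesis using S3_closed(2) abc by blast
qed

theorem mainTheorem2:
  shows "subgroup G GL \<and> stabilizes G V \<and>
    (\<forall>H. subgroup H GL \<and> stabilizes H V \<longrightarrow> H \<subseteq> G) \<and>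
    G = G0 \<union> (oct_Lmul E_down <#\<^bsub>GL\<^esub> G0) \<and>
    G0 \<inter> (oct_Lmul E_down <#\<^bsub>GL\<^esub> G0) = {} \<and>
    G0 = {Diag (Rmul a o\<^sub>L Lmul c) (Rmul b o\<^sub>L Lmul c) | a b c. a \<in> S3 \<and> b \<in> S3 \<and> c \<in> S3} \<and>
    qcnj \<in> O3 \<and> Im_matrix qcnj = - mat 1 \<and>
    (\<exists>\<theta>.
      \<theta> \<in> epi (GL\<lparr>carrier := G\<rparr>) O3_group \<and>
      {g \<in> G. \<theta> g \<in> SO3} = G0 \<and>
      {g \<in> G. \<theta> g \<in> O3_minus} = oct_Lmul E_down <#\<^bsub>GL\<^esub> G0 \<and>
      (\<forall>g\<in>G0. \<exists>a\<in>S3. \<exists>b\<in>S3. g = Diag (Rmul a o\<^sub>L \<theta> g) (Rmul b o\<^sub>L \<theta> g)) \<and>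
      (\<forall>g\<in>G. \<forall>q q'. B (blinfun_apply g q) (blinfun_apply g q') = blinfun_apply (\<theta> g) (B q q')) \<and>
      (\<forall>g\<in>G0. \<theta> (oct_Lmul E_down o\<^sub>L g) = \<theta> g o\<^sub>L qcnj \<and>
                \<theta> (oct_Lmul E_down o\<^sub>L g) = qcnj o\<^sub>L \<theta> g) \<and>
      (\<forall>a\<in>S3. \<forall>b\<in>S3. \<forall>c\<in>S3.
         \<theta> (Diag (Rmul a o\<^sub>L Lmul c) (Rmul b o\<^sub>L Lmul c)) = Int_quat c))"
proof (intro conjI exI[of _ theta])
  show "\<forall>H. subgroup H GL \<and> stabilizes H V \<longrightarrow> H \<subseteq> G" using stabilizer_subset_G by blast
  show "\<forall>g\<in>G0. theta (J o\<^sub>L g) = theta g o\<^sub>L qcnj \<and> theta (J o\<^sub>L g) = qcnj o\<^sub>L theta g"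
    unfolding G0_eq by (auto elim!: TwistsE simp: theta_J_twist theta_twist Int_quat_qcnj)
  show "G0 = {twist a b c | a b c. a \<in> S3 \<and> b \<in> S3 \<and> c \<in> S3}"
    unfolding G0_eq Twists_def ..
  show "\<forall>a\<in>S3. \<forall>b\<in>S3. \<forall>c\<in>S3. theta (twist a b c) = Int_quat c"
    by (simp add: theta_twist)
  show "\<forall>g\<in>G. \<forall>q q'. B (blinfun_apply g q) (blinfun_apply g q') = theta g (B q q')"
    using B_theta by blast
  show "\<forall>g\<in>G0. \<exists>a\<in>S3. \<exists>b\<in>S3. g = Diag (Rmul a o\<^sub>L theta g) (Rmul b o\<^sub>L theta g)"
    unfolding G0_eq using twist_theta_form by blast
qed (use subgroup_G stabilizes_G G_eq Twists_disjoint qcnj_in_O3 Im_matrix_qcnj_eq theta_epi theta_preimages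
    in \<open>simp_all only: G0_eq coset_J\<close>)

end
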